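(* A non-autonomous system $(X,f_{1,\infty})$ has the quasi-weak specification property (QSP) if and only if $(X,f_{1,\infty})$ is topologically mixing.
   Context: A non-autonomous (discrete) system $(X,f_{1,\infty})$ consists of a compact metric space $(X,d)$ and a sequence $f_{1,\infty}=(f_n)_{n\ge 1}$ of continuous surjective maps $f_n:X\to X$. Write $\mathbb{N}=\{1,2,\dots\}$ and $f_1^n=f_n\circ\cdots\circ f_1$. $(X,f_{1,\infty})$ has the quasi-weak specification property (QSP) if for every $\epsilon>0$ there is a positive integer $M(\epsilon)$ such that for any $x_1,x_2\in X$ and any $n\ge M(\epsilon)$ there is $z\in X$ with $d(z,x_1)<\epsilon$ and $d(f_1^n(z),f_1^n(x_2))<\epsilon$. $(X,f_{1,\infty})$ is topologically mixing if for every pair of non-empty open subsets $U,V$ of $X$ there is $n_0\in\mathbb{N}$ such that $f_1^n(U)\cap V\neq\emptyset$ for all $n\ge n_0$. *)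

theory Defs
  imports "HOL-Analysis.Elementary_Metric_Spaces"
begin

text \<open>
  The space \<open>X\<close> is a compact subset of an ambient metric space, with the restricted metric.
  Only the values \<open>f n x\<close> with \<open>n \<ge> 1\<close> and \<open>x \<in> X\<close> are relevant; \<open>f 0\<close> is never used.
\<close>

definition nonautonomous_system :: "'a::metric_space set \<Rightarrow> (nat \<Rightarrow> 'a \<Rightarrow> 'a) \<Rightarrow> bool" where
  "nonautonomous_system X f \<longleftrightarrow>
     compact X \<and> (\<forall>n\<ge>1. continuous_on X (f n) \<and> f n ` X = X)"

text \<open>\<open>iter f n = f n \<circ> \<dots> \<circ> f 1\<close>\<close>

primrec iter :: "(nat \<Rightarrow> 'a \<Rightarrow> 'a) \<Rightarrow> nat \<Rightarrow> 'a \<Rightarrow> 'a" where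
  "iter f 0 = id"
| "iter f (Suc n) = f (Suc n) \<circ> iter f n"

definition quasi_weak_specification ::
    "'a::metric_space set \<Rightarrow> (nat \<Rightarrow> 'a \<Rightarrow> 'a) \<Rightarrow> bool" where
  "quasi_weak_specification X f \<longleftrightarrow>
     (\<forall>\<epsilon>>0. \<exists>M\<ge>1. \<forall>x1\<in>X. \<forall>x2\<in>X. \<forall>n\<ge>M.
        \<exists>z\<in>X. dist z x1 < \<epsilon> \<and> dist (iter f n z) (iter f n x2) < \<epsilon>)"

definition topologically_mixing ::
    "'a::metric_space set \<Rightarrow> (nat \<Rightarrow> 'a \<Rightarrow> 'a) \<Rightarrow> bool" where
  "topologically_mixing X f \<longleftrightarrow>
     (\<forall>U V. openin (top_of_set X) U \<and> U \<noteq> {} \<and> openin (top_of_set X) V \<and> V \<noteq> {} \<longrightarrow>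
        (\<exists>n0\<ge>1. \<forall>n\<ge>n0. iter f n ` U \<inter> V \<noteq> {}))"

end

theory Submission
  imports Defs
begin

lemma iter_image:
  assumes "nonautonomous_system X f"
  shows "iter f n ` X = X"
proof (induction n)
  case (Suc n)
  then have "iter f (Suc n) ` X = f (Suc n) ` X"
    by (simp flip: image_image add: o_def)
  with assms show ?case
    by (simp add: nonautonomous_system_def)
qed simp

lemma iter_mem:
  assumes "nonautonomous_system X f" and "x \<in> X"
  shows "iter f n x \<in> X"
  using imageI[OF assms(2), of "iter f n"] by (simp only: iter_image[OF assms(1)])

text \<open>Pick \<open>u\<close> in \<open>U\<close> and \<open>v\<close> in \<open>V\<close>.
  Surjectivity of \<open>iter f n\<close> gives \<open>w\<close> with \<open>iter f n w = v\<close>,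
  and the specification property for the pair \<open>u\<close>, \<open>w\<close> yields a point near
  \<open>u\<close> whose image is near \<open>v\<close>.\<close>

lemma quasi_weak_specification_imp_topologically_mixing:
  assumes "nonautonomous_system X f" and "quasi_weak_specification X f"
  shows "topologically_mixing X f"
  unfolding topologically_mixing_def
proof (intro allI impI)
  fix U V
  assume *: "openin (top_of_set X) U \<and> U \<noteq> {} \<and> openin (top_of_set X) V \<and> V \<noteq> {}"
  then obtain u v where u: "u \<in> U" and v: "v \<in> V" by blast
  have "u \<in> X" "v \<in> X" using * u v openin_imp_subset by blast+
  obtain d where d: "d > 0" "ball u d \<inter> X \<subseteq> U"
    using * u unfolding openin_contains_ball by blast
  obtain e where e: "e > 0" "ball v e \<inter> X \<subseteq> V"
    using * v unfolding openin_contains_ball by blast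
  \<comment> \<open>The precision \<open>min d e\<close> serves both balls at once. This
    \<open>M\<close> is fixed before \<open>n\<close>, so it may be used with a second point that
    varies with \<open>n\<close>.\<close>
  obtain M where M: "M \<ge> 1"
    "\<And>x1 x2 n. \<lbrakk>x1 \<in> X; x2 \<in> X; n \<ge> M\<rbrakk>
       \<Longrightarrow> \<exists>z\<in>X. dist z x1 < min d e \<and> dist (iter f n z) (iter f n x2) < min d e"
    using assms(2)[unfolded quasi_weak_specification_def, rule_format, of "min d e"] d(1) e(1)
    by auto
  have "iter f n ` U \<inter> V \<noteq> {}" if n: "n \<ge> M" for n
  proof -
    \<comment> \<open>The preimage \<open>w\<close> depends on \<open>n\<close>, which is harmless
      because \<open>M\<close> is uniform in \<open>x2\<close>.\<close>
    have "v \<in> iter f n ` X"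
      using \<open>v \<in> X\<close> by (simp only: iter_image[OF assms(1)])
    then obtain w where w: "w \<in> X" "iter f n w = v" by blast
    obtain z where z: "z \<in> X" "dist z u < d" "dist (iter f n z) v < e"
      using M(2)[OF \<open>u \<in> X\<close> w(1) n] w(2) by auto
    have "iter f n z \<in> X" using iter_mem[OF assms(1) z(1)] .
    with z have "z \<in> ball u d \<inter> X" "iter f n z \<in> ball v e \<inter> X"
      by (auto simp: dist_commute)
    then have "z \<in> U" "iter f n z \<in> V"
      using d(2) e(2) by blast+
    then show ?thesis by blast
  qed
  with M(1) show "\<exists>n0\<ge>1. \<forall>n\<ge>n0. iter f n ` U \<inter> V \<noteq> {}" by blast
qed

text \<open>Uniformity of \<open>M\<close> in the two points comes from a finite cover of \<open>X\<close> by balls of radius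
  \<open>\<epsilon>/2\<close>: only finitely many pairs of open sets have to be fed to the mixing hypothesis.\<close>

lemma topologically_mixing_imp_quasi_weak_specification:
  assumes "nonautonomous_system X f" and "topologically_mixing X f"
  shows "quasi_weak_specification X f"
  unfolding quasi_weak_specification_def
proof (intro allI impI)
  fix \<epsilon> :: real
  assume "\<epsilon> > 0"
  define B where "B a = X \<inter> ball a (\<epsilon>/2)" for a
  have "seq_compact X"
    using assms(1) by (simp add: nonautonomous_system_def compact_imp_seq_compact)
  \<comment> \<open>The centres lie in \<open>X\<close>, so each \<open>B a\<close> with
    \<open>a \<in> K\<close> contains \<open>a\<close> and is a nonempty relatively open
    set.\<close>
  then obtain K where K: "finite K" "K \<subseteq> X" "X \<subseteq> (\<Union>a\<in>K. ball a (\<epsilon>/2))"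
    using seq_compact_imp_totally_bounded[of X] half_gt_zero[OF \<open>\<epsilon> > 0\<close>] by blast
  have "openin (top_of_set X) (B a)" for a
    by (simp add: B_def openin_open_Int)
  moreover have "B a \<noteq> {}" if "a \<in> K" for a
    using that K(2) \<open>\<epsilon> > 0\<close> by (auto simp: B_def)
  ultimately have "\<exists>N\<ge>1. \<forall>n\<ge>N. iter f n ` B a \<inter> B b \<noteq> {}" if "a \<in> K" "b \<in> K" for a b
    using assms(2)[unfolded topologically_mixing_def, rule_format, of "B a" "B b"] that by simp
  then obtain N where N:
    "\<And>a b n. \<lbrakk>a \<in> K; b \<in> K; n \<ge> N a b\<rbrakk> \<Longrightarrow> iter f n ` B a \<inter> B b \<noteq> {}"
    by metis
  \<comment> \<open>Inserting \<open>1\<close> gives \<open>M \<ge> 1\<close> and keeps the maximum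
    meaningful when \<open>K\<close> is empty.\<close>
  define M where "M = Max (insert 1 (case_prod N ` (K \<times> K)))"
  have M: "N a b \<le> M" if "a \<in> K" "b \<in> K" for a b
  proof -
    have "case_prod N (a, b) \<in> insert 1 (case_prod N ` (K \<times> K))"
      using that by blast
    then show ?thesis
      unfolding M_def using K(1) Max_ge[of "insert 1 (case_prod N ` (K \<times> K))" "N a b"] by simp
  qed
  have "M \<ge> 1"
    unfolding M_def using K(1) by (intro Max_ge) auto
  moreover have "\<exists>z\<in>X. dist z x1 < \<epsilon> \<and> dist (iter f n z) (iter f n x2) < \<epsilon>"
    if x: "x1 \<in> X" "x2 \<in> X" and n: "n \<ge> M" for x1 x2 n
  proof -
    obtain a where a: "a \<in> K" "dist a x1 < \<epsilon>/2"
      using subsetD[OF K(3) x(1)] by (auto simp only: UN_iff mem_ball)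
    \<comment> \<open>The second ball is chosen around the image \<open>iter f n x2\<close>, not
      around \<open>x2\<close>. Thus \<open>b\<close> varies with \<open>n\<close>, but
      \<open>M\<close> bounds \<open>N a b\<close> for every pair of centres.\<close>
    obtain b where b: "b \<in> K" "dist b (iter f n x2) < \<epsilon>/2"
      using subsetD[OF K(3) iter_mem[OF assms(1) x(2)]] by (auto simp only: UN_iff mem_ball)
    obtain z where z: "z \<in> B a" "iter f n z \<in> B b"
      using N[OF a(1) b(1) order_trans[OF M[OF a(1) b(1)] n]] by blast
    \<comment> \<open>Both \<open>z\<close> and \<open>x1\<close> are within
      \<open>\<epsilon>/2\<close> of \<open>a\<close>, and both images are within
      \<open>\<epsilon>/2\<close> of \<open>b\<close>.\<close>
    have "dist z x1 < \<epsilon>" "dist (iter f n z) (iter f n x2) < \<epsilon>"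
      using dist_triangle_half_r[of a z \<epsilon> x1] dist_triangle_half_r[of b "iter f n z" \<epsilon> "iter f n x2"]
        z a(2) b(2) by (simp_all add: B_def)
    with z(1) show ?thesis by (auto simp: B_def)
  qed
  ultimately show "\<exists>M\<ge>1. \<forall>x1\<in>X. \<forall>x2\<in>X. \<forall>n\<ge>M.
      \<exists>z\<in>X. dist z x1 < \<epsilon> \<and> dist (iter f n z) (iter f n x2) < \<epsilon>"
    by blast
qed

theorem theorem4p1:
  fixes X :: "'a::metric_space set" and f :: "nat \<Rightarrow> 'a \<Rightarrow> 'a"
  assumes "nonautonomous_system X f"
  shows "quasi_weak_specification X f \<longleftrightarrow> topologically_mixing X f"
  using assms quasi_weak_specification_imp_topologically_mixing
    topologically_mixing_imp_quasi_weak_specification by blast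

end
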